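(* Let $X$ be a Hausdorff zero-dimensional topological space and let $F$ be a totally ordered field (with its order topology) that is either uncountable or a countable subfield of $\mathbb{R}$. For $p\in\beta_0X$ put $$M^{p,F}_c=\{f\in C_c(X,F): p\in \mathrm{cl}_{\beta_0X}Z_c(f)\}.$$ Then $\{M^{p,F}_c: p\in\beta_0X\}$ is the complete list of maximal ideals of $C_c(X,F)$; that is, each $M^{p,F}_c$ is a maximal ideal of $C_c(X,F)$ and every maximal ideal of $C_c(X,F)$ is of the form $M^{p,F}_c$ for some $p\in\beta_0X$.
   Context: A totally ordered field $F$ carries its order (interval) topology. $C_c(X,F)$ is the commutative ring with unity (pointwise operations) of all continuous functions $f:X\to F$ whose range $f(X)$ is countable, and $Z_c(f)=\{x\in X: f(x)=0\}$. A space is zero-dimensional if it has a base of clopen sets. The Banaschewski compactification $\beta_0X$ of a Hausdorff zero-dimensional space $X$ is the (unique up to equivalence of compactifications) zero-dimensional Hausdorff compactification of $X$ such that every continuous map from $X$ to a compact Hausdorff zero-dimensional space $Y$ extends to a continuous map $\beta_0X\to Y$; $X$ is regarded as a dense subspace of $\beta_0X$. *)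

theory Defs
  imports "HOL-Analysis.Analysis" "HOL-Algebra.Ideal"
begin

(* HOL-Algebra's setoid closure clashes with the topological closure_of. *)
no_notation eq_closure_of ("closure'_of\<index>")

section \<open>Zero-dimensional spaces\<close>

definition zero_dimensional_space :: "'a topology \<Rightarrow> bool" where
  "zero_dimensional_space X \<longleftrightarrow>
    (\<exists>\<B>. (\<forall>U\<in>\<B>. openin X U \<and> closedin X U) \<and>
         (\<forall>W. openin X W \<longleftrightarrow> (\<exists>\<U>\<subseteq>\<B>. W = \<Union>\<U>)))"

lemma zero_dimensional_space_alt:
  "zero_dimensional_space X \<longleftrightarrow>
    (\<forall>W x. openin X W \<and> x \<in> W \<longrightarrow> (\<exists>U. openin X U \<and> closedin X U \<and> x \<in> U \<and> U \<subseteq> W))"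
  (is "?L \<longleftrightarrow> ?R")
proof
  assume ?L
  then obtain \<B> where B: "\<forall>U\<in>\<B>. openin X U \<and> closedin X U"
      "\<forall>W. openin X W \<longleftrightarrow> (\<exists>\<U>\<subseteq>\<B>. W = \<Union>\<U>)"
    unfolding zero_dimensional_space_def by (elim exE conjE)
  show ?R
  proof (intro allI impI)
    fix W x assume W: "openin X W \<and> x \<in> W"
    have "openin X W" using W ..
    then have "\<exists>\<U>\<subseteq>\<B>. W = \<Union>\<U>" by (rule iffD1[OF spec[OF B(2)]])
    then obtain \<U> where "\<U> \<subseteq> \<B>" "W = \<Union>\<U>" by (elim exE conjE)
    then show "\<exists>U. openin X U \<and> closedin X U \<and> x \<in> U \<and> U \<subseteq> W"
      using W B(1) by blast
  qed
next
  assume R: ?R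
  let ?B = "{U. openin X U \<and> closedin X U}"
  have "openin X W \<longleftrightarrow> (\<exists>\<U>\<subseteq>?B. W = \<Union>\<U>)" for W
  proof
    assume W: "openin X W"
    have "W = \<Union>{U \<in> ?B. U \<subseteq> W}"
      using R W by blast
    then show "\<exists>\<U>\<subseteq>?B. W = \<Union>\<U>" by (intro exI[of _ "{U \<in> ?B. U \<subseteq> W}"]) blast
  next
    assume "\<exists>\<U>\<subseteq>?B. W = \<Union>\<U>"
    then show "openin X W" by blast
  qed
  then show ?L
    unfolding zero_dimensional_space_def by (intro exI[of _ ?B]) blast
qed

section \<open>The Banaschewski compactification\<close>

text \<open>
  A compactification of \<open>X\<close> is a pair \<open>(B, e)\<close> with \<open>e\<close> a dense embedding of \<open>X\<close> into \<open>B\<close>.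
  A HOL formula cannot quantify over types, so the test spaces \<open>Y\<close> of the universal property
  carry the type \<^typ>\<open>'a set set\<close>, where \<^typ>\<open>'a\<close> is the point type of \<open>X\<close>. This is no restriction:
  a Hausdorff space with a dense image of \<open>X\<close> injects into \<^typ>\<open>'a set set\<close>.
  Lemma \<open>Banaschewski_compactification_extension\<close> gives the universal property for test spaces
  over every type, and \<open>Banaschewski_compactification_exists\<close> gives existence.
\<close>

definition Banaschewski_compactification ::
    "'a topology \<Rightarrow> 'b topology \<Rightarrow> ('a \<Rightarrow> 'b) \<Rightarrow> bool" where
  "Banaschewski_compactification X B e \<longleftrightarrow>
     compact_space B \<and> Hausdorff_space B \<and> zero_dimensional_space B \<and>
     embedding_map X B e \<and> B closure_of (e ` topspace X) = topspace B \<and>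
     (\<forall>(Y :: 'a set set topology) f.
        compact_space Y \<and> Hausdorff_space Y \<and> zero_dimensional_space Y \<and> continuous_map X Y f
        \<longrightarrow> (\<exists>g. continuous_map B Y g \<and> (\<forall>x\<in>topspace X. g (e x) = f x)))"

lemma zero_dimensional_space_subtopology:
  assumes "zero_dimensional_space X"
  shows "zero_dimensional_space (subtopology X S)"
  unfolding zero_dimensional_space_alt
proof (intro allI impI)
  fix W x assume "openin (subtopology X S) W \<and> x \<in> W"
  then obtain T where T: "openin X T" "W = T \<inter> S" "x \<in> T" "x \<in> S"
    by (auto simp: openin_subtopology)
  then obtain U where "openin X U" "closedin X U" "x \<in> U" "U \<subseteq> T"
    using assms unfolding zero_dimensional_space_alt by meson
  then show "\<exists>U. openin (subtopology X S) U \<and> closedin (subtopology X S) U \<and> x \<in> U \<and> U \<subseteq> W"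
    using T by (intro exI[of _ "U \<inter> S"]) (auto simp: openin_subtopology closedin_subtopology)
qed

lemma homeomorphic_zero_dimensional_space:
  assumes "homeomorphic_map X Y h" "zero_dimensional_space X"
  shows "zero_dimensional_space Y"
  unfolding zero_dimensional_space_alt
proof (intro allI impI)
  fix W y assume W: "openin Y W \<and> y \<in> W"
  obtain k where k: "homeomorphic_maps X Y h k"
    using assms(1) homeomorphic_map_maps by blast
  have kY: "k y \<in> topspace X" "h (k y) = y"
    using k W openin_subset unfolding homeomorphic_maps_def continuous_map_def by blast+
  have "openin X {x \<in> topspace X. h x \<in> W}"
    using k W unfolding homeomorphic_maps_def continuous_map_def by blast
  then obtain U where U: "openin X U" "closedin X U" "k y \<in> U" "U \<subseteq> {x \<in> topspace X. h x \<in> W}"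
    using assms(2) kY W unfolding zero_dimensional_space_alt
    by (metis (mono_tags, lifting) mem_Collect_eq)
  have "openin Y (h ` U)" "closedin Y (h ` U)"
    using assms(1) U homeomorphic_map_openness_eq homeomorphic_map_closedness_eq by blast+
  moreover have "y \<in> h ` U" using U(3) kY by force
  ultimately show "\<exists>U. openin Y U \<and> closedin Y U \<and> y \<in> U \<and> U \<subseteq> W"
    using U(4) by (intro exI[of _ "h ` U"]) auto
qed

lemma Banaschewski_compactification_extension:
  fixes X :: "'a topology" and B :: "'b topology" and Y :: "'c topology"
  assumes B: "Banaschewski_compactification X B e"
    and Y: "compact_space Y" "Hausdorff_space Y" "zero_dimensional_space Y"
    and f: "continuous_map X Y f"
  shows "\<exists>g. continuous_map B Y g \<and> (\<forall>x\<in>topspace X. g (e x) = f x)"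
proof -
  define K where "K = Y closure_of (f ` topspace X)"
  define i where "i y = {S. S \<subseteq> topspace X \<and> y \<in> Y closure_of (f ` S)}" for y
  have K: "closedin Y K" "K \<subseteq> topspace Y"
    by (auto simp: K_def closure_of_subset_topspace)
  have nmem: False if yK: "y \<in> K" and z: "i y = i z" and
      "openin Y U" "openin Y V" "y \<in> U" "z \<in> V" "disjnt U V" for y z U V
  proof -
    let ?S = "{x \<in> topspace X. f x \<in> U}"
    have "y \<in> Y closure_of (f ` ?S)"
      unfolding in_closure_of
    proof (intro conjI allI impI)
      show "y \<in> topspace Y" using yK K by blast
      fix T assume "y \<in> T \<and> openin Y T"
      then have "openin Y (T \<inter> U)" "y \<in> T \<inter> U" using that by auto
      then obtain w where "w \<in> f ` topspace X" "w \<in> T \<inter> U"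
        using yK unfolding K_def in_closure_of by meson
      then show "\<exists>w. w \<in> f ` ?S \<and> w \<in> T" by auto
    qed
    then have "?S \<in> i z" using z[symmetric] by (auto simp: i_def)
    then have "z \<in> Y closure_of (f ` ?S)" by (simp add: i_def)
    then have "\<exists>w. w \<in> f ` ?S \<and> w \<in> V"
      using that(4,6) unfolding in_closure_of by blast
    then obtain w where "w \<in> f ` ?S" "w \<in> V" by blast
    then show False using that by (auto simp: disjnt_iff)
  qed
  have inj: "inj_on i K"
  proof (rule inj_onI, rule ccontr)
    fix y z assume yz: "y \<in> K" "z \<in> K" "i y = i z" "y \<noteq> z"
    then obtain U V where "openin Y U" "openin Y V" "y \<in> U" "z \<in> V" "disjnt U V"
      using Y(2) K(2) unfolding Hausdorff_space_def by (meson subsetD)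
    then show False by (rule nmem[OF yz(1,3)])
  qed
  define j where "j = inv_into K i"
  define Z where "Z = pullback_topology (i ` K) j (subtopology Y K)"
  have ji: "j (i y) = y" if "y \<in> K" for y using inj that by (simp add: j_def)
  have YK: "topspace (subtopology Y K) = K" using K by auto
  have tZ: "topspace Z = i ` K"
    unfolding Z_def topspace_pullback_topology YK using ji by auto
  have cj: "continuous_map Z (subtopology Y K) j"
    unfolding Z_def by (metis continuous_map_id continuous_map_pullback id_comp comp_id)
  have ci: "continuous_map (subtopology Y K) Z i"
    unfolding Z_def
  proof (rule continuous_map_pullback')
    show "continuous_map (subtopology Y K) (subtopology Y K) (j \<circ> i)"
      by (rule continuous_map_eq[OF continuous_map_id]) (auto simp: ji)
  qed (use YK in auto)
  have hm: "homeomorphic_maps (subtopology Y K) Z i j"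
    unfolding homeomorphic_maps_def using ci cj tZ YK ji by auto
  then have h: "homeomorphic_map (subtopology Y K) Z i"
    using homeomorphic_map_maps by blast
  have hs: "subtopology Y K homeomorphic_space Z" using hm homeomorphic_space_def by blast
  have "compact_space Z"
    using hs homeomorphic_compact_space closedin_compact_space[OF Y(1) K(1)] compactin_subspace by blast
  moreover have "Hausdorff_space Z"
    using hs homeomorphic_Hausdorff_space Hausdorff_space_subtopology[OF Y(2)] by blast
  moreover have "zero_dimensional_space Z"
    using h homeomorphic_zero_dimensional_space zero_dimensional_space_subtopology[OF Y(3)] by blast
  moreover have fK: "f ` topspace X \<subseteq> K"
    unfolding K_def using f
    by (intro closure_of_subset) (auto simp: continuous_map_def)
  then have "continuous_map X (subtopology Y K) f"
    using f by (auto simp: continuous_map_in_subtopology)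
  then have "continuous_map X Z (i \<circ> f)" using ci continuous_map_compose by blast
  ultimately obtain g where g: "continuous_map B Z g" "\<forall>x\<in>topspace X. g (e x) = (i \<circ> f) x"
    using B unfolding Banaschewski_compactification_def by blast
  have "continuous_map B (subtopology Y K) (j \<circ> g)"
    using g(1) cj continuous_map_compose by blast
  then have "continuous_map B Y (j \<circ> g)"
    by (simp add: continuous_map_in_subtopology)
  then show ?thesis using g(2) ji fK by (intro exI[of _ "j \<circ> g"]) auto
qed

lemma Banaschewski_compactification_exists:
  fixes X :: "'a topology"
  assumes X: "Hausdorff_space X" "zero_dimensional_space X"
  shows "\<exists>(B :: ('a set \<Rightarrow> bool) topology) e. Banaschewski_compactification X B e"
proof -
  define C where "C = {U. openin X U \<and> closedin X U}"
  define P where "P = product_topology (\<lambda>U::'a set. discrete_topology (UNIV::bool set)) C"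
  define e where "e x = (\<lambda>U\<in>C. x \<in> U)" for x
  define K where "K = P closure_of (e ` topspace X)"
  define B where "B = subtopology P K"
  have tP: "topspace P = PiE C (\<lambda>_. UNIV)" by (simp add: P_def)
  have eP: "e ` topspace X \<subseteq> topspace P" by (auto simp: tP e_def)
  have eK: "e ` topspace X \<subseteq> K" unfolding K_def by (rule closure_of_subset[OF eP])
  have KP: "K \<subseteq> topspace P" by (auto simp: K_def closure_of_subset_topspace)
  have tB: "topspace B = K" using KP by (auto simp: B_def)
  have coord: "continuous_map P (discrete_topology UNIV) (\<lambda>u. u U)" if "U \<in> C" for U
    unfolding P_def by (rule continuous_map_product_projection[OF that])
  have coordB: "continuous_map B (discrete_topology UNIV) (\<lambda>u. u U)" if "U \<in> C" for U
    unfolding B_def by (rule continuous_map_from_subtopology[OF coord[OF that]])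
  have opB: "openin B {u \<in> K. u U = b}" if "U \<in> C" for U b
    using openin_continuous_map_preimage[OF coordB[OF that], of "{b}"] by (simp add: tB)
  have opP: "openin P {u \<in> topspace P. u U = b}" if "U \<in> C" for U b
    using openin_continuous_map_preimage[OF coord[OF that], of "{b}"] by simp
  have dense: "\<exists>x\<in>topspace X. \<forall>U\<in>F. x \<in> U \<longleftrightarrow> u U" if "u \<in> K" "finite F" "F \<subseteq> C" for u F
  proof -
    let ?W = "topspace P \<inter> \<Inter>((\<lambda>U. {v \<in> topspace P. v U = u U}) ` F)"
    have W: "openin P ?W"
    proof (cases "F = {}")
      case False
      then have "openin P (\<Inter>((\<lambda>U. {v \<in> topspace P. v U = u U}) ` F))"
        using that opP by (intro openin_Inter) auto
      then show ?thesis by blast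
    qed auto
    moreover have "u \<in> ?W" using that KP by auto
    ultimately have "\<exists>w. w \<in> e ` topspace X \<and> w \<in> ?W"
      using that(1) unfolding K_def in_closure_of by blast
    then obtain w where "w \<in> e ` topspace X" "w \<in> ?W" by blast
    then show ?thesis using that(3) by (force simp: e_def)
  qed
  have cB: "compact_space B"
  proof -
    have "compact_space P" by (auto simp: P_def compact_space_product_topology compact_space_discrete_topology)
    then show ?thesis unfolding B_def K_def
      using closedin_compact_space closedin_closure_of compactin_subspace by blast
  qed
  have hB: "Hausdorff_space B"
    unfolding B_def P_def
    by (intro Hausdorff_space_subtopology) (simp add: Hausdorff_space_product_topology)
  have zB: "zero_dimensional_space B"
    unfolding B_def
  proof (rule zero_dimensional_space_subtopology, unfold zero_dimensional_space_alt, intro allI impI)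
    fix W u assume "openin P W \<and> u \<in> W"
    then obtain U where U: "finite {i \<in> C. U i \<noteq> UNIV}" "u \<in> PiE C U" "PiE C U \<subseteq> W"
      unfolding P_def openin_product_topology_alt by auto
    have "openin P (PiE C U)" using U(1) by (simp add: P_def openin_PiE_gen)
    moreover have "closedin P (PiE C U)" by (simp add: P_def closedin_product_topology)
    ultimately show "\<exists>U. openin P U \<and> closedin P U \<and> u \<in> U \<and> U \<subseteq> W" using U by blast
  qed
  have sep: "\<exists>U\<in>C. x \<in> U \<and> U \<subseteq> W" if "openin X W" "x \<in> W" for x W
    using X(2) that unfolding zero_dimensional_space_alt C_def by blast
  have inj: "inj_on e (topspace X)"
  proof (rule inj_onI, rule ccontr)
    fix x y assume xy: "x \<in> topspace X" "y \<in> topspace X" "e x = e y" "x \<noteq> y"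
    then obtain S T where "openin X S" "x \<in> S" "y \<in> T" "disjnt S T"
      using X(1) unfolding Hausdorff_space_def by meson
    then obtain U where "U \<in> C" "x \<in> U" "y \<notin> U" using sep by (metis disjnt_iff subsetD)
    then show False using fun_cong[OF xy(3), of U] by (simp add: e_def)
  qed
  have ce: "continuous_map X B e"
  proof -
    have "continuous_map X P e"
      unfolding P_def continuous_map_componentwise
    proof (intro conjI ballI)
      show "e ` topspace X \<subseteq> extensional C" by (auto simp: e_def)
      fix U assume U: "U \<in> C"
      have "openin X {x \<in> topspace X. (x \<in> U) \<in> V}" for V :: "bool set"
      proof -
        have "{x \<in> topspace X. (x \<in> U) \<in> V} =
          (if True \<in> V then U else {}) \<union> (if False \<in> V then topspace X - U else {})"
          using U openin_subset[of X U] by (auto simp: C_def split: if_splits) (metis (full_types))+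
        then show ?thesis using U by (auto simp: C_def openin_Un closedin_def)
      qed
      then show "continuous_map X (discrete_topology UNIV) (\<lambda>x. e x U)"
        using U by (simp add: e_def continuous_map_def)
    qed
    then show ?thesis using eK by (auto simp: B_def continuous_map_in_subtopology)
  qed
  have emb: "embedding_map X B e"
    unfolding embedding_map_def
  proof (rule bijective_open_imp_homeomorphic_map)
    show "continuous_map X (subtopology B (e ` topspace X)) e"
      using ce by (auto simp: continuous_map_in_subtopology)
    show "e ` topspace X = topspace (subtopology B (e ` topspace X))"
      using eK tB by auto
    show "inj_on e (topspace X)" by (rule inj)
    show "open_map X (subtopology B (e ` topspace X)) e"
      unfolding open_map_def
    proof (intro allI impI)
      fix W assume W: "openin X W"
      let ?V = "\<Union>U\<in>{U \<in> C. U \<subseteq> W}. {u \<in> K. u U = True}"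
      have "openin B ?V" using opB[of _ True] by (intro openin_Union) auto
      moreover have "e ` W = ?V \<inter> e ` topspace X"
      proof (intro Set.set_eqI iffI)
        fix u assume "u \<in> e ` W"
        then obtain x where x: "x \<in> W" "u = e x" by blast
        then obtain U where U: "U \<in> C" "x \<in> U" "U \<subseteq> W" using sep W by blast
        have "x \<in> topspace X" using x W openin_subset by blast
        then show "u \<in> ?V \<inter> e ` topspace X" using x U eK
          by (auto simp: e_def image_subset_iff intro!: exI[of _ U])
      next
        fix u assume "u \<in> ?V \<inter> e ` topspace X"
        then show "u \<in> e ` W" by (auto simp: e_def split: if_splits)
      qed
      ultimately show "openin (subtopology B (e ` topspace X)) (e ` W)"
        by (auto simp: openin_subtopology)
    qed
  qed
  have dB: "B closure_of (e ` topspace X) = topspace B"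
    unfolding tB unfolding B_def using eK
    by (simp add: closure_of_subtopology Int_absorb1 K_def)
  have ext: "\<exists>g. continuous_map B Y g \<and> (\<forall>x\<in>topspace X. g (e x) = f x)"
    if Y: "compact_space Y" "Hausdorff_space Y" "zero_dimensional_space Y"
      and f: "continuous_map X Y f" for Y :: "'a set set topology" and f
  proof -
    define pr where "pr V = {x \<in> topspace X. f x \<in> V}" for V
    define D where "D = {V. openin Y V \<and> closedin Y V}"
    have prC: "pr V \<in> C" if "V \<in> D" for V
      using that f openin_continuous_map_preimage closedin_continuous_map_preimage
      unfolding C_def D_def pr_def by blast
    have fY: "f x \<in> topspace Y" if "x \<in> topspace X" for x
      using that f by (auto simp: continuous_map_def)
    have "\<exists>y\<in>topspace Y. \<forall>V\<in>D. y \<in> V \<longleftrightarrow> u (pr V)" if u: "u \<in> K" for u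
    proof -
      let ?F = "insert (topspace Y) {V \<in> D. u (pr V)}"
      have fip: "\<Inter>\<F> \<noteq> {}" if "finite \<F>" "\<F> \<subseteq> ?F" for \<F>
      proof -
        have "pr ` (\<F> - {topspace Y}) \<subseteq> C" using \<open>\<F> \<subseteq> ?F\<close> prC by auto
        then obtain x where x: "x \<in> topspace X" "\<forall>U \<in> pr ` (\<F> - {topspace Y}). x \<in> U \<longleftrightarrow> u U"
          using dense[OF u, of "pr ` (\<F> - {topspace Y})"] \<open>finite \<F>\<close> by blast
        have "f x \<in> V" if "V \<in> \<F>" for V
          using that x \<open>\<F> \<subseteq> ?F\<close> fY by (cases "V = topspace Y") (auto simp: pr_def)
        then show ?thesis by blast
      qed
      have "\<forall>V\<in>?F. closedin Y V" by (auto simp: D_def)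
      then have "\<Inter>?F \<noteq> {}" using Y(1) fip unfolding compact_space_fip by blast
      then obtain y where y: "y \<in> topspace Y" "\<And>V. V \<in> D \<Longrightarrow> u (pr V) \<Longrightarrow> y \<in> V" by auto
      have "\<not> (y \<in> V \<and> \<not> u (pr V))" if V: "V \<in> D" for V
      proof
        assume a: "y \<in> V \<and> \<not> u (pr V)"
        have V': "topspace Y - V \<in> D" using V by (auto simp: D_def closedin_def)
        obtain x where x: "x \<in> topspace X" "\<forall>U\<in>{pr V, pr (topspace Y - V)}. x \<in> U \<longleftrightarrow> u U"
          using dense[OF u, of "{pr V, pr (topspace Y - V)}"] prC V V' by auto
        then have "u (pr (topspace Y - V))" using a fY[OF x(1)] by (auto simp: pr_def)
        then show False using y(2)[OF V'] a by blast
      qed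
      then show ?thesis using y by blast
    qed
    then obtain g where g: "\<And>u. u \<in> K \<Longrightarrow> g u \<in> topspace Y"
        "\<And>u V. u \<in> K \<Longrightarrow> V \<in> D \<Longrightarrow> g u \<in> V \<longleftrightarrow> u (pr V)"
      by metis
    have "continuous_map B Y g"
      unfolding continuous_map_def tB
    proof (intro conjI allI impI)
      show "g \<in> K \<rightarrow> topspace Y" using g by auto
      fix W assume W: "openin Y W"
      have "{u \<in> K. g u \<in> W} = (\<Union>V\<in>{V \<in> D. V \<subseteq> W}. {u \<in> K. u (pr V) = True})"
      proof (intro Set.set_eqI iffI)
        fix u assume u: "u \<in> {u \<in> K. g u \<in> W}"
        then obtain V where "V \<in> D" "g u \<in> V" "V \<subseteq> W"
          using Y(3) W unfolding zero_dimensional_space_alt D_def by blast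
        then show "u \<in> (\<Union>V\<in>{V \<in> D. V \<subseteq> W}. {u \<in> K. u (pr V) = True})" using u g(2) by auto
      next
        fix u assume "u \<in> (\<Union>V\<in>{V \<in> D. V \<subseteq> W}. {u \<in> K. u (pr V) = True})"
        then show "u \<in> {u \<in> K. g u \<in> W}" using g(2) by auto
      qed
      moreover have "openin B (\<Union>V\<in>{V \<in> D. V \<subseteq> W}. {u \<in> K. u (pr V) = True})"
        using opB[of _ True] prC by (intro openin_Union) auto
      ultimately show "openin B {u \<in> K. g u \<in> W}" by simp
    qed
    moreover have "g (e x) = f x" if x: "x \<in> topspace X" for x
    proof (rule ccontr)
      assume ne: "g (e x) \<noteq> f x"
      have ex: "e x \<in> K" using eK x by blast
      obtain S T where "openin Y S" "g (e x) \<in> S" "f x \<in> T" "disjnt S T"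
        using Y(2) g(1)[OF ex] fY[OF x] ne unfolding Hausdorff_space_def by meson
      moreover from this obtain V where "V \<in> D" "g (e x) \<in> V" "V \<subseteq> S"
        using Y(3) unfolding zero_dimensional_space_alt D_def by blast
      moreover from this have "e x (pr V)" using g(2)[OF ex] by blast
      ultimately show False using prC by (auto simp: e_def pr_def disjnt_iff)
    qed
    ultimately show ?thesis by blast
  qed
  show ?thesis
    unfolding Banaschewski_compactification_def
    using cB hB zB emb dB ext by blast
qed

section \<open>Rings of continuous functions with countable range\<close>

text \<open>
  An ordered field with its order topology is a type of sort
  \<open>{linordered_field, linorder_topology}\<close>. A function on the carrier of \<open>X\<close> is represented by its
  extension by \<open>undefined\<close>, so that equality of elements is equality on \<open>topspace X\<close>.
\<close>

definition Cc_ring ::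
    "'a topology \<Rightarrow> ('a \<Rightarrow> 'f::{linordered_field,linorder_topology}) ring" where
  "Cc_ring X =
    \<lparr>carrier = {f \<in> extensional (topspace X).
                  continuous_map X euclidean f \<and> countable (f ` topspace X)},
     mult = (\<lambda>f g. \<lambda>x\<in>topspace X. f x * g x),
     one = (\<lambda>x\<in>topspace X. 1),
     zero = (\<lambda>x\<in>topspace X. 0),
     add = (\<lambda>f g. \<lambda>x\<in>topspace X. f x + g x)\<rparr>"

definition zero_set :: "'a topology \<Rightarrow> ('a \<Rightarrow> 'f::zero) \<Rightarrow> 'a set" where
  "zero_set X f = {x \<in> topspace X. f x = 0}"

definition M_ideal ::
    "'a topology \<Rightarrow> 'b topology \<Rightarrow> ('a \<Rightarrow> 'b) \<Rightarrow> 'b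
      \<Rightarrow> ('a \<Rightarrow> 'f::{linordered_field,linorder_topology}) set" where
  "M_ideal X B e p = {f \<in> carrier (Cc_ring X). p \<in> B closure_of (e ` zero_set X f)}"

text \<open>
  An embedding into the reals identifies an ordered field with a subfield of the reals; the order
  topology is transported, since it depends on the order alone.
\<close>

definition ordered_field_embedding :: "('f::linordered_field \<Rightarrow> 'g::linordered_field) \<Rightarrow> bool" where
  "ordered_field_embedding \<phi> \<longleftrightarrow>
     strict_mono \<phi> \<and> \<phi> 1 = 1 \<and>
     (\<forall>x y. \<phi> (x + y) = \<phi> x + \<phi> y) \<and> (\<forall>x y. \<phi> (x * y) = \<phi> x * \<phi> y)"

end

theory Submission
  imports Defs
begin

text \<open>
  A nowhere vanishing element of \<open>C\<^sub>c(X,F)\<close> is invertible, so an element of a proper ideal has a zero.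
  Since \<open>f\<^sup>2 + g\<^sup>2\<close> vanishes exactly where \<open>f\<close> and \<open>g\<close> both do, the zero sets of a proper ideal \<open>I\<close>
  have the finite intersection property, and so do their closures in \<open>\<beta>\<^sub>0X\<close>. Compactness yields a point
  \<open>p\<close> common to all these closures, which means \<open>I \<subseteq> M\<^sup>p\<close> (\<open>proper_ideal_subset_M_ideal\<close>). It remains to
  see that every \<open>M\<^sup>p\<close> is a maximal ideal.

  Maximality rests on clopen indicators. If \<open>p\<close> is not in the closure of \<open>Z(f)\<close>, some clopen \<open>W\<close>
  disjoint from \<open>Z(f)\<close> has \<open>p\<close> in its closure. The indicator \<open>i\<close> of the complement of \<open>W\<close> lies in
  \<open>M\<^sup>p\<close>, and \<open>f\<^sup>2 + i\<^sup>2\<close> is a unit in every ideal that contains \<open>f\<close> and \<open>M\<^sup>p\<close>.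

  The crux is that \<open>M\<^sup>p\<close> is closed under addition. This follows from
  \<open>cl Z(f) \<inter> cl Z(g) = cl (Z(f) \<inter> Z(g))\<close> (\<open>closure_of_zero_sets_Int\<close>), which reduces, by cutting
  down to a clopen set, to the case of disjoint zero sets. Two such sets are separated by a clopen set
  \<open>U\<close> (\<open>disjoint_zero_sets_clopen_separation\<close>), and the indicator of \<open>U\<close>, as a map into a two-point
  discrete space, extends to \<open>\<beta>\<^sub>0X\<close> and keeps the two closures apart. To find \<open>U\<close>, take
  \<open>h = f\<^sup>2 / (f\<^sup>2 + g\<^sup>2)\<close>, which is \<open>0\<close> on \<open>Z(f)\<close> and \<open>1\<close> on \<open>Z(g)\<close>, and cut its countable range
  between \<open>0\<close> and \<open>1\<close> at a place that it misses. This is the only use of the hypothesis on \<open>F\<close>: an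
  uncountable \<open>F\<close> has an element of \<open>(0,1)\<close> outside the range, and a countable subfield of the reals
  has a gap in \<open>(0,1)\<close> at a real number outside the subfield.
\<close>

section \<open>Limits in an ordered field\<close>

text \<open>
  An ordered field carries the topology of its order, which need not come from a metric. The epsilon description with values in the field itself recovers the
  usual arguments for continuity of the field operations.
\<close>

lemma tendsto_order_field_iff:
  fixes l :: "'f::{linordered_field,linorder_topology}"
  shows "(f \<longlongrightarrow> l) F \<longleftrightarrow> (\<forall>\<epsilon>>0. \<forall>\<^sub>F x in F. \<bar>f x - l\<bar> < \<epsilon>)"
proof
  assume "(f \<longlongrightarrow> l) F"
  then have "\<forall>\<^sub>F x in F. l - \<epsilon> < f x" "\<forall>\<^sub>F x in F. f x < l + \<epsilon>" if "\<epsilon> > 0" for \<epsilon>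
    using that unfolding order_tendsto_iff by simp_all
  then show "\<forall>\<epsilon>>0. \<forall>\<^sub>F x in F. \<bar>f x - l\<bar> < \<epsilon>"
    by (auto simp: abs_less_iff algebra_simps intro: eventually_elim2)
next
  assume E: "\<forall>\<epsilon>>0. \<forall>\<^sub>F x in F. \<bar>f x - l\<bar> < \<epsilon>"
  show "(f \<longlongrightarrow> l) F"
  proof (rule order_tendstoI)
    fix a assume "a < l"
    then show "\<forall>\<^sub>F x in F. a < f x"
      using E[rule_format, of "l - a"] by (auto simp: abs_less_iff elim!: eventually_mono)
  next
    fix a assume "l < a"
    then show "\<forall>\<^sub>F x in F. f x < a"
      using E[rule_format, of "a - l"] by (auto simp: abs_less_iff elim!: eventually_mono)
  qed
qed

lemma tendsto_order_field_add:
  fixes a b :: "'f::{linordered_field,linorder_topology}"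
  assumes "(f \<longlongrightarrow> a) F" "(g \<longlongrightarrow> b) F"
  shows "((\<lambda>x. f x + g x) \<longlongrightarrow> a + b) F"
  unfolding tendsto_order_field_iff
proof (intro allI impI)
  fix \<epsilon> :: 'f assume "\<epsilon> > 0"
  then have "\<epsilon> / 2 > 0" by simp
  then have "\<forall>\<^sub>F x in F. \<bar>f x - a\<bar> < \<epsilon> / 2" "\<forall>\<^sub>F x in F. \<bar>g x - b\<bar> < \<epsilon> / 2"
    using assms unfolding tendsto_order_field_iff by blast+
  then show "\<forall>\<^sub>F x in F. \<bar>f x + g x - (a + b)\<bar> < \<epsilon>"
  proof eventually_elim
    case (elim x)
    have "\<bar>f x + g x - (a + b)\<bar> \<le> \<bar>f x - a\<bar> + \<bar>g x - b\<bar>"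
      using abs_triangle_ineq[of "f x - a" "g x - b"] by (simp add: algebra_simps)
    also have "\<dots> < \<epsilon> / 2 + \<epsilon> / 2" using elim by (rule add_strict_mono)
    finally show ?case by simp
  qed
qed

lemma tendsto_order_field_mult:
  fixes a b :: "'f::{linordered_field,linorder_topology}"
  assumes "(f \<longlongrightarrow> a) F" "(g \<longlongrightarrow> b) F"
  shows "((\<lambda>x. f x * g x) \<longlongrightarrow> a * b) F"
  unfolding tendsto_order_field_iff
proof (intro allI impI)
  fix \<epsilon> :: 'f assume \<epsilon>: "\<epsilon> > 0"
  define C where "C = 1 + \<bar>a\<bar> + \<bar>b\<bar>"
  define \<delta> where "\<delta> = min 1 (\<epsilon> / C)"
  have C: "C > 0" by (simp add: C_def add_pos_nonneg)
  have \<delta>: "0 < \<delta>" "\<delta> \<le> 1" using \<epsilon> C by (auto simp: \<delta>_def)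
  have "\<delta> \<le> \<epsilon> / C" by (simp add: \<delta>_def)
  then have \<delta>C: "\<delta> * C \<le> \<epsilon>" using C by (simp add: pos_le_divide_eq)
  have "\<forall>\<^sub>F x in F. \<bar>f x - a\<bar> < \<delta>" "\<forall>\<^sub>F x in F. \<bar>g x - b\<bar> < \<delta>"
    using assms \<delta>(1) unfolding tendsto_order_field_iff by simp_all
  then show "\<forall>\<^sub>F x in F. \<bar>f x * g x - a * b\<bar> < \<epsilon>"
  proof eventually_elim
    case (elim x)
    have "f x * g x - a * b = (f x - a) * (g x - b) + (a * (g x - b) + b * (f x - a))"
      by (simp add: algebra_simps)
    then have "\<bar>f x * g x - a * b\<bar> \<le> \<bar>(f x - a) * (g x - b)\<bar> + (\<bar>a * (g x - b)\<bar> + \<bar>b * (f x - a)\<bar>)"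
      using abs_triangle_ineq[of "(f x - a) * (g x - b)" "a * (g x - b) + b * (f x - a)"]
        abs_triangle_ineq[of "a * (g x - b)" "b * (f x - a)"] by linarith
    also have "\<dots> = \<bar>f x - a\<bar> * \<bar>g x - b\<bar> + (\<bar>a\<bar> * \<bar>g x - b\<bar> + \<bar>b\<bar> * \<bar>f x - a\<bar>)"
      by (simp add: abs_mult)
    also have "\<dots> < \<delta> * 1 + (\<bar>a\<bar> * \<delta> + \<bar>b\<bar> * \<delta>)"
    proof (rule add_less_le_mono)
      have "\<bar>f x - a\<bar> * \<bar>g x - b\<bar> \<le> \<bar>f x - a\<bar> * 1"
        using elim \<delta>(2) by (intro mult_left_mono) auto
      then show "\<bar>f x - a\<bar> * \<bar>g x - b\<bar> < \<delta> * 1" using elim by simp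
      show "\<bar>a\<bar> * \<bar>g x - b\<bar> + \<bar>b\<bar> * \<bar>f x - a\<bar> \<le> \<bar>a\<bar> * \<delta> + \<bar>b\<bar> * \<delta>"
        using elim by (intro add_mono mult_left_mono) auto
    qed
    also have "\<dots> = \<delta> * C" by (simp add: C_def algebra_simps)
    finally show ?case using \<delta>C by simp
  qed
qed

lemma tendsto_order_field_inverse:
  fixes a :: "'f::{linordered_field,linorder_topology}"
  assumes "(f \<longlongrightarrow> a) F" "a \<noteq> 0"
  shows "((\<lambda>x. inverse (f x)) \<longlongrightarrow> inverse a) F"
  unfolding tendsto_order_field_iff
proof (intro allI impI)
  fix \<epsilon> :: 'f assume \<epsilon>: "\<epsilon> > 0"
  \<comment> \<open>The first bound keeps \<open>\<bar>f x\<bar>\<close> above \<open>\<bar>a\<bar> / 2\<close>; the second absorbs the denominator \<open>\<bar>f x\<bar> * \<bar>a\<bar>\<close>.\<close>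
  define \<delta> where "\<delta> = min (\<bar>a\<bar> / 2) (\<epsilon> * (\<bar>a\<bar> / 2 * \<bar>a\<bar>))"
  have \<delta>: "0 < \<delta>" "\<delta> \<le> \<bar>a\<bar> / 2" "\<delta> \<le> \<epsilon> * (\<bar>a\<bar> / 2 * \<bar>a\<bar>)"
    unfolding \<delta>_def using \<epsilon> assms(2)
    by (simp_all only: min_less_iff_conj min.cobounded1 min.cobounded2)
      (intro conjI mult_pos_pos divide_pos_pos; simp)
  have "\<forall>\<^sub>F x in F. \<bar>f x - a\<bar> < \<delta>"
    using assms \<delta>(1) unfolding tendsto_order_field_iff by simp
  then show "\<forall>\<^sub>F x in F. \<bar>inverse (f x) - inverse a\<bar> < \<epsilon>"
  proof eventually_elim
    case (elim x)
    have "\<bar>a\<bar> \<le> \<bar>f x - a\<bar> + \<bar>f x\<bar>"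
      using abs_triangle_ineq2_sym[of a "f x"] by (simp add: abs_minus_commute algebra_simps)
    moreover have "\<bar>a\<bar> = \<bar>a\<bar> / 2 + \<bar>a\<bar> / 2" by simp
    ultimately have fa: "\<bar>a\<bar> / 2 < \<bar>f x\<bar>" using elim \<delta>(2) by linarith
    then have f0: "f x \<noteq> 0" using assms(2) by auto
    have "inverse (f x) - inverse a = (a - f x) / (f x * a)"
      using f0 assms(2) by (simp add: field_simps)
    then have "\<bar>inverse (f x) - inverse a\<bar> = \<bar>f x - a\<bar> / (\<bar>f x\<bar> * \<bar>a\<bar>)"
      by (simp add: abs_mult abs_minus_commute)
    also have "\<dots> < \<epsilon>"
    proof -
      have "\<bar>f x - a\<bar> < \<epsilon> * (\<bar>a\<bar> / 2 * \<bar>a\<bar>)" using elim \<delta>(3) by simp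
      also have "\<dots> \<le> \<epsilon> * (\<bar>f x\<bar> * \<bar>a\<bar>)"
        using \<epsilon> fa by (intro mult_left_mono mult_right_mono) auto
      finally show ?thesis using f0 assms(2) by (simp add: pos_divide_less_eq)
    qed
    finally show ?case .
  qed
qed

lemma continuous_map_euclidean_iff_tendsto:
  "continuous_map X euclidean f \<longleftrightarrow> (\<forall>x\<in>topspace X. (f \<longlongrightarrow> f x) (atin X x))"
  by (simp add: continuous_map_atin)

section \<open>The ring of continuous functions with countable range\<close>

lemma Cc_ring_simps:
  "mult (Cc_ring X) = (\<lambda>f g. \<lambda>x\<in>topspace X. f x * g x)"
  "one (Cc_ring X) = (\<lambda>x\<in>topspace X. 1)"
  "zero (Cc_ring X) = (\<lambda>x\<in>topspace X. 0)"
  "add (Cc_ring X) = (\<lambda>f g. \<lambda>x\<in>topspace X. f x + g x)"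
  by (simp_all add: Cc_ring_def)

lemma restrict_in_Cc_ring_iff:
  "restrict f (topspace X) \<in> carrier (Cc_ring X) \<longleftrightarrow>
    continuous_map X euclidean f \<and> countable (f ` topspace X)"
proof -
  have "continuous_map X euclidean (restrict f (topspace X)) \<longleftrightarrow> continuous_map X euclidean f"
    using continuous_map_eq[of X euclidean f "restrict f (topspace X)"]
      continuous_map_eq[of X euclidean "restrict f (topspace X)" f] by auto
  then show ?thesis by (auto simp: Cc_ring_def)
qed

lemma Cc_ring_memD:
  assumes "f \<in> carrier (Cc_ring X)"
  shows "f \<in> extensional (topspace X)" "continuous_map X euclidean f" "countable (f ` topspace X)"
  using assms by (auto simp: Cc_ring_def)

text \<open>
  The range of \<open>h (f x) (g x)\<close> is the image of a subset of the product of the two countable ranges.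
\<close>

lemma Cc_ring_pointwise_closed:
  assumes f: "f \<in> carrier (Cc_ring X)" and g: "g \<in> carrier (Cc_ring X)"
    and h: "\<And>F a b. (f \<longlongrightarrow> a) F \<Longrightarrow> (g \<longlongrightarrow> b) F \<Longrightarrow> ((\<lambda>x. h (f x) (g x)) \<longlongrightarrow> h a b) F"
  shows "(\<lambda>x\<in>topspace X. h (f x) (g x)) \<in> carrier (Cc_ring X)"
  unfolding restrict_in_Cc_ring_iff
proof
  show "continuous_map X euclidean (\<lambda>x. h (f x) (g x))"
    using Cc_ring_memD(2)[OF f] Cc_ring_memD(2)[OF g] h
    by (simp add: continuous_map_euclidean_iff_tendsto)
  have "(\<lambda>x. h (f x) (g x)) ` topspace X \<subseteq> case_prod h ` (f ` topspace X \<times> g ` topspace X)"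
    by auto
  then show "countable ((\<lambda>x. h (f x) (g x)) ` topspace X)"
    by (rule countable_subset) (intro countable_image countable_SIGMA Cc_ring_memD(3)[OF f] Cc_ring_memD(3)[OF g])
qed

lemma Cc_ring_add_closed:
  assumes "f \<in> carrier (Cc_ring X)" "g \<in> carrier (Cc_ring X)"
  shows "(\<lambda>x\<in>topspace X. f x + g x) \<in> carrier (Cc_ring X)"
  by (rule Cc_ring_pointwise_closed[where h="\<lambda>a b. a + b", OF assms tendsto_order_field_add])

lemma Cc_ring_mult_closed:
  assumes "f \<in> carrier (Cc_ring X)" "g \<in> carrier (Cc_ring X)"
  shows "(\<lambda>x\<in>topspace X. f x * g x) \<in> carrier (Cc_ring X)"
  by (rule Cc_ring_pointwise_closed[where h="\<lambda>a b. a * b", OF assms tendsto_order_field_mult])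

lemma Cc_ring_const: "(\<lambda>x\<in>topspace X. c) \<in> carrier (Cc_ring X)"
  unfolding restrict_in_Cc_ring_iff by (auto simp: image_constant_conv)

lemma Cc_ring_inverse_closed:
  assumes f: "f \<in> carrier (Cc_ring X)" and "zero_set X f = {}"
  shows "(\<lambda>x\<in>topspace X. inverse (f x)) \<in> carrier (Cc_ring X)"
  unfolding restrict_in_Cc_ring_iff
proof
  show "continuous_map X euclidean (\<lambda>x. inverse (f x))"
    using Cc_ring_memD(2)[OF f] assms(2) tendsto_order_field_inverse
    by (fastforce simp: continuous_map_euclidean_iff_tendsto zero_set_def)
  show "countable ((\<lambda>x. inverse (f x)) ` topspace X)"
    using countable_image[OF Cc_ring_memD(3)[OF f], of inverse] by (simp add: image_image)
qed

lemma Cc_ring_indicator: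
  assumes U: "openin X U" "closedin X U"
  shows "(\<lambda>x\<in>topspace X. of_bool (x \<in> U)) \<in> carrier (Cc_ring X)"
  unfolding restrict_in_Cc_ring_iff
proof
  have "openin X {x \<in> topspace X. of_bool (x \<in> U) \<in> S}" for S :: "'b set"
  proof -
    have "{x \<in> topspace X. of_bool (x \<in> U) \<in> S} =
        (if 1 \<in> S then U else {}) \<union> (if 0 \<in> S then topspace X - U else {})"
      using openin_subset[OF U(1)] by (auto split: if_splits)
    then show ?thesis using U by (auto simp: openin_Un)
  qed
  then show "continuous_map X euclidean (\<lambda>x. of_bool (x \<in> U) :: 'b)"
    by (simp add: continuous_map_def)
  have "(\<lambda>x. of_bool (x \<in> U) :: 'b) ` topspace X \<subseteq> {0, 1}" by auto
  then show "countable ((\<lambda>x. of_bool (x \<in> U) :: 'b) ` topspace X)"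
    by (rule countable_subset) simp
qed

lemma cring_Cc_ring: "cring (Cc_ring X :: ('a \<Rightarrow> 'f::{linordered_field,linorder_topology}) ring)"
proof -
  let ?R = "Cc_ring X :: ('a \<Rightarrow> 'f) ring"
  have restr: "restrict f (topspace X) = f" if "f \<in> carrier ?R" for f
    using extensional_restrict[OF Cc_ring_memD(1)[OF that]] .
  have zero: "\<zero>\<^bsub>?R\<^esub> \<oplus>\<^bsub>?R\<^esub> f = f" and one: "\<one>\<^bsub>?R\<^esub> \<otimes>\<^bsub>?R\<^esub> f = f" if "f \<in> carrier ?R" for f
    using restr[OF that] by (simp_all add: Cc_ring_simps cong: restrict_cong)
  show ?thesis
  proof (rule cringI)
    show "abelian_group ?R"
    proof (rule abelian_groupI)
      fix f g h assume f: "f \<in> carrier ?R" and g: "g \<in> carrier ?R"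
      show "f \<oplus>\<^bsub>?R\<^esub> g \<in> carrier ?R"
        using Cc_ring_add_closed[OF f g] by (simp add: Cc_ring_simps)
      show "f \<oplus>\<^bsub>?R\<^esub> g = g \<oplus>\<^bsub>?R\<^esub> f" by (simp add: Cc_ring_simps add.commute)
      show "f \<oplus>\<^bsub>?R\<^esub> g \<oplus>\<^bsub>?R\<^esub> h = f \<oplus>\<^bsub>?R\<^esub> (g \<oplus>\<^bsub>?R\<^esub> h)"
        by (simp add: Cc_ring_simps add.assoc cong: restrict_cong)
      have "(\<lambda>x\<in>topspace X. (\<lambda>x\<in>topspace X. - 1) x * f x) \<in> carrier ?R"
        by (intro Cc_ring_mult_closed Cc_ring_const f)
      then show "\<exists>g\<in>carrier ?R. g \<oplus>\<^bsub>?R\<^esub> f = \<zero>\<^bsub>?R\<^esub>"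
        by (rule bexI[rotated]) (simp add: Cc_ring_simps cong: restrict_cong)
    qed (use zero Cc_ring_const in \<open>simp_all add: Cc_ring_simps\<close>)
    show "comm_monoid ?R"
    proof (rule comm_monoidI)
      fix f g h assume f: "f \<in> carrier ?R" and g: "g \<in> carrier ?R"
      show "f \<otimes>\<^bsub>?R\<^esub> g \<in> carrier ?R"
        using Cc_ring_mult_closed[OF f g] by (simp add: Cc_ring_simps)
      show "f \<otimes>\<^bsub>?R\<^esub> g = g \<otimes>\<^bsub>?R\<^esub> f" by (simp add: Cc_ring_simps mult.commute)
      show "f \<otimes>\<^bsub>?R\<^esub> g \<otimes>\<^bsub>?R\<^esub> h = f \<otimes>\<^bsub>?R\<^esub> (g \<otimes>\<^bsub>?R\<^esub> h)"
        by (simp add: Cc_ring_simps mult.assoc cong: restrict_cong)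
    qed (use one Cc_ring_const in \<open>simp_all add: Cc_ring_simps\<close>)
  qed (simp add: Cc_ring_simps distrib_right cong: restrict_cong)
qed

definition sum_squares where
  "sum_squares X f g = (\<lambda>x\<in>topspace X. f x * f x + g x * g x)"

lemma sum_squares_alt:
  "sum_squares X f g = f \<otimes>\<^bsub>Cc_ring X\<^esub> f \<oplus>\<^bsub>Cc_ring X\<^esub> g \<otimes>\<^bsub>Cc_ring X\<^esub> g"
  by (auto simp: sum_squares_def Cc_ring_simps fun_eq_iff)

lemma sum_squares_closed:
  assumes "f \<in> carrier (Cc_ring X)" "g \<in> carrier (Cc_ring X)"
  shows "sum_squares X f g \<in> carrier (Cc_ring X)"
proof -
  interpret cring "Cc_ring X" by (rule cring_Cc_ring)
  show ?thesis using assms by (simp add: sum_squares_alt)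
qed

lemma sum_squares_in_ideal:
  assumes "ideal J (Cc_ring X)" "f \<in> J" "g \<in> J"
  shows "sum_squares X f g \<in> J"
proof -
  interpret ideal J "Cc_ring X" by (rule assms(1))
  show ?thesis
    using assms(2,3) by (simp add: sum_squares_alt a_closed I_l_closed Icarr)
qed

lemma zero_set_sum_squares:
  fixes f g :: "'a \<Rightarrow> 'f::linordered_field"
  shows "zero_set X (sum_squares X f g) = zero_set X f \<inter> zero_set X g"
  by (auto simp: zero_set_def sum_squares_def sum_squares_eq_zero_iff)

text \<open>
  The reciprocal of a nonvanishing function is continuous, and its range is the image of a countable
  set, so the function is a unit.
\<close>

lemma ideal_with_nonvanishing_element:
  assumes J: "ideal J (Cc_ring X)" and f: "f \<in> J" "zero_set X f = {}"
  shows "J = carrier (Cc_ring X)"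
proof -
  interpret ideal J "Cc_ring X" by (rule J)
  have "(\<lambda>x\<in>topspace X. inverse (f x)) \<otimes>\<^bsub>Cc_ring X\<^esub> f \<in> J"
    using f by (intro I_l_closed Cc_ring_inverse_closed Icarr)
  moreover have "(\<lambda>x\<in>topspace X. inverse (f x)) \<otimes>\<^bsub>Cc_ring X\<^esub> f = \<one>\<^bsub>Cc_ring X\<^esub>"
    using f(2) by (auto simp: Cc_ring_simps zero_set_def fun_eq_iff)
  ultimately show ?thesis using one_imp_carrier by simp
qed

section \<open>Separating disjoint zero sets by clopen sets\<close>

text \<open>
  Negation and inversion carry the open unit interval onto everything except \<open>0\<close>, \<open>1\<close> and \<open>-1\<close>,
  so it cannot be countable in an uncountable field.
\<close>

lemma uncountable_unit_interval:
  assumes "uncountable (UNIV :: 'f::linordered_field set)"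
  shows "uncountable {0<..<1 :: 'f}"
proof
  let ?I = "{0<..<1 :: 'f}"
  assume I: "countable ?I"
  have "x \<in> {0, 1, -1} \<union> ?I \<union> inverse ` ?I \<union> uminus ` ?I \<union> uminus ` inverse ` ?I" for x :: 'f
  proof -
    have pos: "y = 1 \<or> y \<in> ?I \<or> y \<in> inverse ` ?I" if "y > 0" for y :: 'f
    proof (cases "y > 1")
      case True
      then have "inverse y \<in> ?I" "y = inverse (inverse y)" by (auto simp: inverse_less_1_iff)
      then show ?thesis by blast
    qed (use that in auto)
    consider "x = 0" | "x > 0" | "- x > 0" by force
    then show ?thesis
    proof cases
      case 3
      have "x = - (- x)" by simp
      then show ?thesis using pos[OF 3] by (metis UnI1 UnI2 image_eqI insertI1 insert_commute)
    qed (use pos[of x] in auto)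
  qed
  then have "UNIV \<subseteq> {0, 1, -1} \<union> ?I \<union> inverse ` ?I \<union> uminus ` ?I \<union> uminus ` inverse ` ?I"
    by blast
  then have "countable (UNIV :: 'f set)"
    by (rule countable_subset) (intro countable_Un countable_image I countable_finite finite.intros)
  then show False using assms by blast
qed

text \<open>
  An ordered subfield of the reals contains the reciprocals of the natural numbers, so one can move
  from \<open>x\<close> towards \<open>c\<close> by a positive step of the subfield without reaching \<open>c\<close>. Hence the lower
  side of the cut has no greatest element and the upper side no least one.
\<close>

lemma open_preimages_real_cut:
  fixes \<phi> :: "'f::{linordered_field,linorder_topology} \<Rightarrow> real"
  assumes \<phi>: "ordered_field_embedding \<phi>"
  shows "open {x. \<phi> x < c}" "open {x. c < \<phi> x}"
proof -
  have add: "\<phi> (x + y) = \<phi> x + \<phi> y" and mult: "\<phi> (x * y) = \<phi> x * \<phi> y"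
    and one: "\<phi> 1 = 1" and sm: "strict_mono \<phi>" for x y
    using \<phi> by (auto simp: ordered_field_embedding_def)
  have zero: "\<phi> 0 = 0" using add[of 0 0] by simp
  have nat: "\<phi> (of_nat n) = of_nat n" for n by (induction n) (simp_all add: add one zero)
  have small: "\<exists>d>0. \<phi> d < r" if r: "r > 0" for r
  proof -
    obtain n where n: "n > 0" "inverse (of_nat n) < r" using ex_inverse_of_nat_less[OF r] by blast
    have "\<phi> (of_nat n) * \<phi> (inverse (of_nat n)) = 1"
      using mult[of "of_nat n" "inverse (of_nat n)"] n(1) one by simp
    then have "\<phi> (inverse (of_nat n)) = inverse (of_nat n)"
      using n(1) by (simp add: nat field_simps)
    then show ?thesis using n by (intro exI[of _ "inverse (of_nat n)"]) simp
  qed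
  show "open {x. \<phi> x < c}"
  proof (rule Topological_Spaces.openI)
    fix x assume "x \<in> {x. \<phi> x < c}"
    then obtain d where "d > 0" "\<phi> d < c - \<phi> x" using small[of "c - \<phi> x"] by auto
    then have "x \<in> {..<x + d}" "{..<x + d} \<subseteq> {x. \<phi> x < c}"
      using add[of x d] strict_monoD[OF sm] by fastforce+
    then show "\<exists>T. open T \<and> x \<in> T \<and> T \<subseteq> {x. \<phi> x < c}" by (meson open_lessThan)
  qed
  show "open {x. c < \<phi> x}"
  proof (rule Topological_Spaces.openI)
    fix x assume "x \<in> {x. c < \<phi> x}"
    then obtain d where "d > 0" "\<phi> d < \<phi> x - c" using small[of "\<phi> x - c"] by auto
    then have "x \<in> {x - d<..}" "{x - d<..} \<subseteq> {x. c < \<phi> x}"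
      using add[of "x - d" d] strict_monoD[OF sm] by fastforce+
    then show "\<exists>T. open T \<and> x \<in> T \<and> T \<subseteq> {x. c < \<phi> x}" by (meson open_greaterThan)
  qed
qed

text \<open>
  This is the common consequence of the two alternatives for the field. The two sides are arbitrary
  open sets, not rays with an endpoint in the field, because in a countable field the cut
  has to be made at a gap.
\<close>

definition cuts_avoid_countable_sets :: "'f::{linordered_field,linorder_topology} itself \<Rightarrow> bool" where
  "cuts_avoid_countable_sets _ \<longleftrightarrow>
    (\<forall>S :: 'f set. countable S \<longrightarrow>
      (\<exists>L R. open L \<and> open R \<and> L \<inter> R = {} \<and> S \<subseteq> L \<union> R \<and> 0 \<in> L \<and> 1 \<in> R))"

lemma cuts_avoid_countable_sets:
  assumes "uncountable (UNIV :: 'f::{linordered_field,linorder_topology} set) \<or>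
         (countable (UNIV :: 'f set) \<and> (\<exists>\<phi> :: 'f \<Rightarrow> real. ordered_field_embedding \<phi>))"
  shows "cuts_avoid_countable_sets TYPE('f)"
  unfolding cuts_avoid_countable_sets_def
proof (intro allI impI)
  fix S :: "'f set" assume S: "countable S"
  from assms show "\<exists>L R. open L \<and> open R \<and> L \<inter> R = {} \<and> S \<subseteq> L \<union> R \<and> 0 \<in> L \<and> 1 \<in> R"
  proof (elim disjE conjE exE)
    assume "uncountable (UNIV :: 'f set)"
    then have "\<not> {0<..<1} \<subseteq> S" using uncountable_unit_interval S countable_subset by blast
    then obtain c where "0 < c" "c < 1" "c \<notin> S" by (meson greaterThanLessThan_iff subsetI)
    then have "open {..<c} \<and> open {c<..} \<and> {..<c} \<inter> {c<..} = {} \<and> S \<subseteq> {..<c} \<union> {c<..} \<and>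
        0 \<in> {..<c} \<and> 1 \<in> {c<..}"
      by (auto simp: not_less order_le_less)
    then show ?thesis by blast
  next
    fix \<phi> :: "'f \<Rightarrow> real"
    assume F: "countable (UNIV :: 'f set)" and \<phi>: "ordered_field_embedding \<phi>"
    have "\<phi> 1 = 1" "\<phi> (0 + 0) = \<phi> 0 + \<phi> 0" using \<phi> unfolding ordered_field_embedding_def by blast+
    then have \<phi>01: "\<phi> 0 = 0" "\<phi> 1 = 1" by simp_all
    have "countable (range \<phi>)" using F by (rule countable_image)
    then have "\<not> {0<..<1} \<subseteq> range \<phi>"
      using uncountable_unit_interval[OF uncountable_UNIV_real] by (metis countable_subset)
    then obtain c where c: "0 < c" "c < 1" "c \<notin> range \<phi>" by (meson greaterThanLessThan_iff subsetI)
    then have "\<phi> x < c \<or> c < \<phi> x" for x by (metis linorder_neqE rangeI)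
    then have "open {x. \<phi> x < c} \<and> open {x. c < \<phi> x} \<and> {x. \<phi> x < c} \<inter> {x. c < \<phi> x} = {} \<and>
        S \<subseteq> {x. \<phi> x < c} \<union> {x. c < \<phi> x} \<and> 0 \<in> {x. \<phi> x < c} \<and> 1 \<in> {x. c < \<phi> x}"
      using c \<phi>01 open_preimages_real_cut[OF \<phi>] by auto
    then show ?thesis by blast
  qed
qed

lemma disjoint_zero_sets_clopen_separation:
  fixes f g :: "'a \<Rightarrow> 'f::{linordered_field,linorder_topology}"
  assumes cuts: "cuts_avoid_countable_sets TYPE('f)"
    and f: "f \<in> carrier (Cc_ring X)" and g: "g \<in> carrier (Cc_ring X)"
    and disj: "zero_set X f \<inter> zero_set X g = {}"
  obtains U where "openin X U" "closedin X U" "zero_set X f \<subseteq> U" "zero_set X g \<inter> U = {}"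
proof -
  let ?s = "sum_squares X f g"
  define h where "h = (\<lambda>x\<in>topspace X. (\<lambda>x\<in>topspace X. f x * f x) x * (\<lambda>x\<in>topspace X. inverse (?s x)) x)"
  have h: "h \<in> carrier (Cc_ring X)"
    unfolding h_def using f g disj
    by (intro Cc_ring_mult_closed Cc_ring_inverse_closed sum_squares_closed)
      (simp_all add: zero_set_sum_squares)
  obtain L R where LR: "open L" "open R" "L \<inter> R = {}" "h ` topspace X \<subseteq> L \<union> R" "0 \<in> L" "1 \<in> R"
    using cuts Cc_ring_memD(3)[OF h] unfolding cuts_avoid_countable_sets_def by meson
  define U where "U = {x \<in> topspace X. h x \<in> L}"
  have "topspace X - U = {x \<in> topspace X. h x \<in> R}" using LR(3,4) by (auto simp: U_def)
  moreover have "openin X {x \<in> topspace X. h x \<in> S}" if "open S" for S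
    using openin_continuous_map_preimage[OF Cc_ring_memD(2)[OF h]] that by simp
  ultimately have "openin X U" "closedin X U"
    using LR(1,2) by (auto simp: closedin_def U_def)
  moreover have "zero_set X f \<subseteq> U" using LR(5) by (auto simp: U_def h_def zero_set_def)
  moreover have "zero_set X g \<inter> U = {}"
  proof -
    have "h x = 1" if "x \<in> zero_set X g" for x
    proof -
      have "f x \<noteq> 0" "x \<in> topspace X" "g x = 0" using that disj by (auto simp: zero_set_def)
      then show ?thesis
        by (simp add: h_def sum_squares_def flip: inverse_mult_distrib del: inverse_mult_distrib)
    qed
    then show ?thesis using LR(3,6) by (auto simp: U_def)
  qed
  ultimately show thesis by (rule that)
qed

section \<open>Closures of zero sets in the Banaschewski compactification\<close>

lemma Banaschewski_compactification_continuous_map: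
  assumes "Banaschewski_compactification X B e"
  shows "continuous_map X B e"
proof -
  have "homeomorphic_map X (subtopology B (e ` topspace X)) e"
    using assms by (simp add: Banaschewski_compactification_def embedding_map_def)
  then show ?thesis
    using homeomorphic_imp_continuous_map continuous_map_in_subtopology by blast
qed

text \<open>
  The map deciding membership in \<open>U\<close> goes into a compact zero-dimensional two-point space, hence
  extends over the compactification. The two fibres of the extension are disjoint closed sets, one
  containing \<open>e ` A\<close> and the other \<open>e ` A'\<close>.
\<close>

lemma clopen_separated_closures_disjoint:
  assumes B: "Banaschewski_compactification X B e"
    and U: "openin X U" "closedin X U"
    and A: "A \<subseteq> U" and A': "A' \<subseteq> topspace X" "A' \<inter> U = {}"
  shows "B closure_of (e ` A) \<inter> B closure_of (e ` A') = {}"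
proof -
  have UX: "U \<subseteq> topspace X" using U(1) by (rule openin_subset)
  have "openin X {x \<in> topspace X. (x \<in> U) \<in> V}" for V :: "bool set"
  proof -
    have "{x \<in> topspace X. (x \<in> U) \<in> V} =
      (if True \<in> V then U else {}) \<union> (if False \<in> V then topspace X - U else {})"
      using UX by (auto split: if_splits) (metis (full_types))+
    then show ?thesis using U by (auto simp: openin_Un)
  qed
  then have "continuous_map X (discrete_topology UNIV) (\<lambda>x. x \<in> U)"
    by (simp add: continuous_map_def)
  moreover have "zero_dimensional_space (discrete_topology (UNIV :: bool set))"
    unfolding zero_dimensional_space_alt by auto
  ultimately obtain u where u: "continuous_map B (discrete_topology UNIV) u"
      "\<And>x. x \<in> topspace X \<Longrightarrow> u (e x) \<longleftrightarrow> x \<in> U"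
    using Banaschewski_compactification_extension[OF B, of "discrete_topology UNIV" "\<lambda>x. x \<in> U"]
    by (auto simp: compact_space_discrete_topology)
  have clo: "closedin B {p \<in> topspace B. u p = b}" for b
    using closedin_continuous_map_preimage[OF u(1), of "{b}"] by simp
  have eB: "e ` topspace X \<subseteq> topspace B"
    using Banaschewski_compactification_continuous_map[OF B]
    by (rule continuous_map_image_subset_topspace)
  have "B closure_of (e ` A) \<subseteq> {p \<in> topspace B. u p = True}"
    using A UX eB u(2) by (intro closure_of_minimal clo) auto
  moreover have "B closure_of (e ` A') \<subseteq> {p \<in> topspace B. u p = False}"
    using A' eB u(2) by (intro closure_of_minimal clo) auto
  ultimately show ?thesis by blast
qed

text \<open>
  The set \<open>W\<close> is the trace on \<open>X\<close> of a clopen neighbourhood of \<open>p\<close> missing \<open>e ` S\<close>. Whether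
  \<open>p\<close> is a limit of \<open>A\<close> is decided inside such a neighbourhood, which gives the last clause.
\<close>

lemma Banaschewski_clopen_nbhd_avoiding:
  assumes B: "Banaschewski_compactification X B e"
    and p: "p \<in> topspace B" "p \<notin> B closure_of (e ` S)"
  obtains W where "openin X W" "closedin X W" "W \<inter> S = {}"
    "\<And>A. A \<subseteq> topspace X \<Longrightarrow> p \<in> B closure_of (e ` A) \<Longrightarrow> p \<in> B closure_of (e ` (A \<inter> W))"
proof -
  have zB: "zero_dimensional_space B"
    using B by (simp add: Banaschewski_compactification_def)
  note e = Banaschewski_compactification_continuous_map[OF B]
  obtain T where "openin B T" "p \<in> T" "T \<inter> e ` S = {}"
    using p unfolding in_closure_of by blast
  then obtain V where V: "openin B V" "closedin B V" "p \<in> V" "V \<inter> e ` S = {}"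
    using zB unfolding zero_dimensional_space_alt by (metis Int_mono order_refl subset_empty)
  define W where "W = {x \<in> topspace X. e x \<in> V}"
  have "p \<in> B closure_of (e ` (A \<inter> W))" if A: "A \<subseteq> topspace X" "p \<in> B closure_of (e ` A)" for A
  proof -
    have "p \<in> B closure_of (V \<inter> e ` A)"
      using openin_Int_closure_of_subset[OF V(1), of "e ` A"] A(2) V(3) by blast
    moreover have "V \<inter> e ` A \<subseteq> e ` (A \<inter> W)" using A(1) by (auto simp: W_def)
    ultimately show ?thesis by (meson closure_of_mono subsetD)
  qed
  moreover have "openin X W" "closedin X W"
    unfolding W_def
    using openin_continuous_map_preimage[OF e V(1)] closedin_continuous_map_preimage[OF e V(2)] by simp_all
  moreover have "W \<inter> S = {}" using V(4) by (auto simp: W_def)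
  ultimately show thesis using that by blast
qed

text \<open>
  If \<open>p\<close> avoided the closure of \<open>Z(f) \<inter> Z(g)\<close>, then a clopen trace \<open>W\<close> would make
  \<open>Z(f) \<inter> W\<close> and \<open>Z(g) \<inter> W\<close> disjoint while \<open>p\<close> stays in both closures. Both sets are
  again zero sets: adding the square of the indicator of the complement of \<open>W\<close> cuts a zero set
  down to \<open>W\<close>. So they are separated by a clopen set, which contradicts the choice of \<open>p\<close>.
\<close>

lemma closure_of_zero_sets_Int:
  fixes f g :: "'a \<Rightarrow> 'f::{linordered_field,linorder_topology}"
  assumes cuts: "cuts_avoid_countable_sets TYPE('f)"
    and B: "Banaschewski_compactification X B e"
    and f: "f \<in> carrier (Cc_ring X)" and g: "g \<in> carrier (Cc_ring X)"
    and pf: "p \<in> B closure_of (e ` zero_set X f)" and pg: "p \<in> B closure_of (e ` zero_set X g)"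
  shows "p \<in> B closure_of (e ` (zero_set X f \<inter> zero_set X g))"
proof (rule ccontr)
  assume np: "p \<notin> B closure_of (e ` (zero_set X f \<inter> zero_set X g))"
  have "p \<in> topspace B" using pf by (simp add: in_closure_of)
  then obtain W where W: "openin X W" "closedin X W" "W \<inter> (zero_set X f \<inter> zero_set X g) = {}"
    "\<And>A. A \<subseteq> topspace X \<Longrightarrow> p \<in> B closure_of (e ` A) \<Longrightarrow> p \<in> B closure_of (e ` (A \<inter> W))"
    using Banaschewski_clopen_nbhd_avoiding[OF B _ np] by blast
  have ZX: "zero_set X k \<subseteq> topspace X" for k :: "'a \<Rightarrow> 'f" by (auto simp: zero_set_def)
  define i :: "'a \<Rightarrow> 'f" where "i = (\<lambda>x\<in>topspace X. of_bool (x \<in> topspace X - W))"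
  have i: "i \<in> carrier (Cc_ring X)"
    unfolding i_def using W(1,2) by (intro Cc_ring_indicator) auto
  have "zero_set X i = W"
    using openin_subset[OF W(1)] by (auto simp: i_def zero_set_def)
  then have Z: "zero_set X (sum_squares X k i) = zero_set X k \<inter> W" for k
    by (simp add: zero_set_sum_squares)
  obtain U where U: "openin X U" "closedin X U" "zero_set X f \<inter> W \<subseteq> U" "(zero_set X g \<inter> W) \<inter> U = {}"
  proof (rule disjoint_zero_sets_clopen_separation[OF cuts
        sum_squares_closed[OF f i] sum_squares_closed[OF g i], unfolded Z])
    show "zero_set X f \<inter> W \<inter> (zero_set X g \<inter> W) = {}" using W(3) by blast
  qed
  have "B closure_of (e ` (zero_set X f \<inter> W)) \<inter> B closure_of (e ` (zero_set X g \<inter> W)) = {}"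
    using U ZX by (intro clopen_separated_closures_disjoint[OF B U(1,2)]) auto
  then show False using W(4)[OF ZX pf] W(4)[OF ZX pg] by blast
qed

section \<open>The maximal ideals\<close>

text \<open>
  Density of \<open>X\<close> puts the zero function, whose zero set is \<open>X\<close>, into \<open>M\<^sup>p\<close>. Sums stay inside
  because \<open>Z(f) \<inter> Z(g) \<subseteq> Z(f + g)\<close>.
\<close>

lemma ideal_M_ideal:
  fixes X :: "'a topology"
  assumes cuts: "cuts_avoid_countable_sets TYPE('f::{linordered_field,linorder_topology})"
    and B: "Banaschewski_compactification X B e" and p: "p \<in> topspace B"
  shows "ideal (M_ideal X B e p) (Cc_ring X :: ('a \<Rightarrow> 'f) ring)"
proof -
  let ?R = "Cc_ring X :: ('a \<Rightarrow> 'f) ring"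
  interpret cring ?R by (rule cring_Cc_ring)
  have mono: "g \<in> M_ideal X B e p"
    if "g \<in> carrier ?R" "p \<in> B closure_of (e ` S)" "S \<subseteq> zero_set X g" for g S
    using that(1,2) closure_of_mono[OF image_mono[OF that(3)], of B e] unfolding M_ideal_def by blast
  have M: "f \<in> carrier ?R" "p \<in> B closure_of (e ` zero_set X f)" if "f \<in> M_ideal X B e p" for f
    using that by (auto simp: M_ideal_def)
  have mult: "g \<otimes>\<^bsub>?R\<^esub> f \<in> M_ideal X B e p" if "f \<in> M_ideal X B e p" "g \<in> carrier ?R" for f g
  proof (rule mono[OF _ M(2)[OF that(1)]])
    show "g \<otimes>\<^bsub>?R\<^esub> f \<in> carrier ?R" using that M(1) by simp
    show "zero_set X f \<subseteq> zero_set X (g \<otimes>\<^bsub>?R\<^esub> f)" by (auto simp: zero_set_def Cc_ring_simps)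
  qed
  show ?thesis
  proof (rule idealI)
    show "ring ?R" by (rule ring_axioms)
    show "subgroup (M_ideal X B e p) (add_monoid ?R)"
    proof (rule subgroup.intro)
      show "M_ideal X B e p \<subseteq> carrier (add_monoid ?R)" by (auto simp: M_ideal_def)
      fix f g :: "'a \<Rightarrow> 'f" assume "f \<in> M_ideal X B e p" "g \<in> M_ideal X B e p"
      note f = M[OF this(1)] and g = M[OF this(2)]
      have "f \<oplus>\<^bsub>?R\<^esub> g \<in> M_ideal X B e p"
      proof (rule mono[OF _ closure_of_zero_sets_Int[OF cuts B f(1) g(1) f(2) g(2)]])
        show "f \<oplus>\<^bsub>?R\<^esub> g \<in> carrier ?R" using f(1) g(1) by simp
        show "zero_set X f \<inter> zero_set X g \<subseteq> zero_set X (f \<oplus>\<^bsub>?R\<^esub> g)"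
          by (auto simp: zero_set_def Cc_ring_simps)
      qed
      then show "f \<otimes>\<^bsub>add_monoid ?R\<^esub> g \<in> M_ideal X B e p" by simp
    next
      have "B closure_of (e ` topspace X) = topspace B"
        using B by (simp add: Banaschewski_compactification_def)
      then have "\<zero>\<^bsub>?R\<^esub> \<in> M_ideal X B e p"
        using p by (intro mono[of _ "topspace X"]) (auto simp: zero_set_def Cc_ring_simps Cc_ring_const)
      then show "\<one>\<^bsub>add_monoid ?R\<^esub> \<in> M_ideal X B e p" by simp
    next
      fix f :: "'a \<Rightarrow> 'f" assume f: "f \<in> M_ideal X B e p"
      have "\<ominus>\<^bsub>?R\<^esub> f = (\<ominus>\<^bsub>?R\<^esub> \<one>\<^bsub>?R\<^esub>) \<otimes>\<^bsub>?R\<^esub> f" using M[OF f] by (simp add: l_minus)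
      then have "\<ominus>\<^bsub>?R\<^esub> f \<in> M_ideal X B e p" using mult[OF f] by simp
      then show "inv\<^bsub>add_monoid ?R\<^esub> f \<in> M_ideal X B e p" by (simp add: a_inv_def)
    qed
    fix f g :: "'a \<Rightarrow> 'f" assume fg: "f \<in> M_ideal X B e p" "g \<in> carrier ?R"
    show "g \<otimes>\<^bsub>?R\<^esub> f \<in> M_ideal X B e p" using mult fg .
    then show "f \<otimes>\<^bsub>?R\<^esub> g \<in> M_ideal X B e p" using fg M by (simp add: m_comm)
  qed
qed

lemma one_notin_M_ideal:
  "\<one>\<^bsub>Cc_ring X :: ('a \<Rightarrow> 'f::{linordered_field,linorder_topology}) ring\<^esub> \<notin> M_ideal X B e p"
proof -
  have "zero_set X (\<one>\<^bsub>Cc_ring X\<^esub> :: 'a \<Rightarrow> 'f) = {}" by (auto simp: zero_set_def Cc_ring_simps)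
  then show ?thesis by (simp add: M_ideal_def)
qed

lemma maximalideal_M_ideal:
  fixes X :: "'a topology"
  assumes cuts: "cuts_avoid_countable_sets TYPE('f::{linordered_field,linorder_topology})"
    and B: "Banaschewski_compactification X B e" and p: "p \<in> topspace B"
  shows "maximalideal (M_ideal X B e p) (Cc_ring X :: ('a \<Rightarrow> 'f) ring)"
proof (rule maximalidealI)
  let ?R = "Cc_ring X :: ('a \<Rightarrow> 'f) ring"
  interpret cring ?R by (rule cring_Cc_ring)
  show "ideal (M_ideal X B e p) ?R" using cuts B p by (rule ideal_M_ideal)
  show "carrier ?R \<noteq> M_ideal X B e p" using one_notin_M_ideal one_closed by metis
  fix J assume J: "ideal J ?R" "M_ideal X B e p \<subseteq> J" "J \<subseteq> carrier ?R"
  have "J = carrier ?R" if "f \<in> J" "f \<notin> M_ideal X B e p" for f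
  proof -
    have "p \<notin> B closure_of (e ` zero_set X f)" using that J(3) by (auto simp: M_ideal_def)
    then obtain W where W: "openin X W" "closedin X W" "W \<inter> zero_set X f = {}"
      "\<And>A. A \<subseteq> topspace X \<Longrightarrow> p \<in> B closure_of (e ` A) \<Longrightarrow> p \<in> B closure_of (e ` (A \<inter> W))"
      using Banaschewski_clopen_nbhd_avoiding[OF B p] by blast
    define i :: "'a \<Rightarrow> 'f" where "i = (\<lambda>x\<in>topspace X. of_bool (x \<in> topspace X - W))"
    have i: "i \<in> carrier ?R"
      unfolding i_def using W(1,2) by (intro Cc_ring_indicator) auto
    have WX: "W \<subseteq> topspace X" using W(1) by (rule openin_subset)
    then have Zi: "zero_set X i = W" by (auto simp: i_def zero_set_def)
    have "B closure_of (e ` topspace X) = topspace B"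
      using B by (simp add: Banaschewski_compactification_def)
    then have "p \<in> B closure_of (e ` W)"
      using W(4)[of "topspace X"] p WX by (simp add: Int_absorb1)
    then have "i \<in> J" using i Zi J(2) by (auto simp: M_ideal_def)
    then have "sum_squares X f i \<in> J" using that(1) J(1) sum_squares_in_ideal by blast
    moreover have "zero_set X (sum_squares X f i) = {}"
      using W(3) by (auto simp: zero_set_sum_squares Zi)
    ultimately show ?thesis using ideal_with_nonvanishing_element J(1) by blast
  qed
  then show "J = M_ideal X B e p \<or> J = carrier ?R" using J(2) by blast
qed

text \<open>
  The closures of the zero sets of members of \<open>I\<close> have the finite intersection property: iterated
  sums of squares produce a single member of \<open>I\<close> vanishing only at common zeros of finitely many
  given ones, and it has a zero because \<open>I\<close> is proper.
\<close>

lemma proper_ideal_subset_M_ideal: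
  fixes X :: "'a topology"
  assumes I: "ideal I (Cc_ring X :: ('a \<Rightarrow> 'f::{linordered_field,linorder_topology}) ring)"
      "I \<noteq> carrier (Cc_ring X)"
    and B: "Banaschewski_compactification X B e"
  shows "\<exists>p\<in>topspace B. I \<subseteq> M_ideal X B e p"
proof -
  let ?R = "Cc_ring X :: ('a \<Rightarrow> 'f) ring"
  interpret ideal I ?R by (rule I(1))
  let ?c = "\<lambda>f. B closure_of (e ` zero_set X f)"
  have cB: "compact_space B"
    using B by (simp add: Banaschewski_compactification_def)
  have eB: "e ` topspace X \<subseteq> topspace B"
    using Banaschewski_compactification_continuous_map[OF B]
    by (rule continuous_map_image_subset_topspace)
  have common: "\<exists>g\<in>I. \<forall>f\<in>\<G>. zero_set X g \<subseteq> zero_set X f" if "finite \<G>" "\<G> \<subseteq> I" for \<G>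
    using that
  proof (induction \<G> rule: finite_induct)
    case empty
    then show ?case using additive_subgroup.zero_closed additive_subgroup_axioms by blast
  next
    case (insert f \<G>)
    then obtain g where "g \<in> I" "\<forall>f\<in>\<G>. zero_set X g \<subseteq> zero_set X f" by auto
    with insert.prems show ?case
      by (intro bexI[of _ "sum_squares X f g"])
        (auto simp: zero_set_sum_squares intro: sum_squares_in_ideal[OF I(1)])
  qed
  have fip: "\<Inter>\<F> \<noteq> {}" if F: "finite \<F>" "\<F> \<subseteq> ?c ` I" for \<F>
  proof -
    obtain \<G> where G: "finite \<G>" "\<G> \<subseteq> I" "\<F> = ?c ` \<G>"
      using finite_subset_image[OF F] by blast
    then obtain g where g: "g \<in> I" "\<forall>f\<in>\<G>. zero_set X g \<subseteq> zero_set X f" using common by blast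
    have "zero_set X g \<noteq> {}" using ideal_with_nonvanishing_element[OF I(1) g(1)] I(2) by blast
    then obtain x where x: "x \<in> zero_set X g" by blast
    have "e x \<in> ?c f" if "f \<in> \<G>" for f
    proof -
      have "e ` zero_set X f \<subseteq> topspace B" using eB by (auto simp: zero_set_def)
      then have "e ` zero_set X f \<subseteq> ?c f" by (rule closure_of_subset)
      then show ?thesis using x g(2) that by blast
    qed
    then show ?thesis using G(3) by blast
  qed
  have "(\<forall>C\<in>?c ` I. closedin B C) \<and> (\<forall>\<F>. finite \<F> \<and> \<F> \<subseteq> ?c ` I \<longrightarrow> \<Inter>\<F> \<noteq> {})"
    using fip by simp
  then have "\<Inter>(?c ` I) \<noteq> {}"
    using cB unfolding compact_space_fip by presburger
  then obtain p where p: "\<And>f. f \<in> I \<Longrightarrow> p \<in> ?c f" by auto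
  \<comment> \<open>Some closure has to be named to see that \<open>p\<close> lies in \<open>B\<close> at all; \<open>I\<close> is inhabited by zero.\<close>
  have "\<zero>\<^bsub>?R\<^esub> \<in> I" by simp
  then have "p \<in> topspace B" using p in_closure_of by metis
  moreover have "I \<subseteq> M_ideal X B e p" using p Icarr by (auto simp: M_ideal_def)
  ultimately show ?thesis by blast
qed

theorem mainTheorem3:
  fixes X :: "'a topology" and B :: "'b topology" and e :: "'a \<Rightarrow> 'b"
  assumes "Hausdorff_space X" and "zero_dimensional_space X"
    and "Banaschewski_compactification X B e"
    and "uncountable (UNIV :: 'f::{linordered_field,linorder_topology} set) \<or>
         (countable (UNIV :: 'f set) \<and> (\<exists>\<phi> :: 'f \<Rightarrow> real. ordered_field_embedding \<phi>))"
  shows "(\<forall>p\<in>topspace B. maximalideal (M_ideal X B e p) (Cc_ring X :: ('a \<Rightarrow> 'f) ring)) \<and>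
         (\<forall>I. maximalideal I (Cc_ring X :: ('a \<Rightarrow> 'f) ring) \<longrightarrow>
              (\<exists>p\<in>topspace B. I = M_ideal X B e p))"
proof (intro conjI ballI allI impI)
  let ?R = "Cc_ring X :: ('a \<Rightarrow> 'f) ring"
  note cuts = cuts_avoid_countable_sets[OF assms(4)]
  show max: "maximalideal (M_ideal X B e p) ?R" if "p \<in> topspace B" for p
    using cuts assms(3) that by (rule maximalideal_M_ideal)
  fix I assume I: "maximalideal I ?R"
  then obtain p where p: "p \<in> topspace B" "I \<subseteq> M_ideal X B e p"
    using proper_ideal_subset_M_ideal[OF _ _ assms(3)]
    by (metis maximalideal.axioms(1) maximalideal.I_notcarr)
  have "ideal (M_ideal X B e p) ?R" "M_ideal X B e p \<noteq> carrier ?R"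
    using maximalideal.axioms(1)[OF max[OF p(1)]] maximalideal.I_notcarr[OF max[OF p(1)]] by auto
  moreover have "M_ideal X B e p \<subseteq> carrier ?R" by (auto simp: M_ideal_def)
  ultimately have "I = M_ideal X B e p" using maximalideal.I_maximal[OF I] p(2) by blast
  then show "\<exists>p\<in>topspace B. I = M_ideal X B e p" using p(1) by blast
qed

end
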